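(* For all D-terms $\delta,\delta'$: the equation $\delta=\delta'$ is derivable in the system S$\Box$ if and only if the D-graphs $\iota(\delta)$ and $\iota(\delta')$ are the same.
   Context: Graphs, D-graphs and juncture: a graph is a pair of functions $W,E\colon A\to V$ with $A\cap V=\emptyset$. $X$ ranges over $\{W,E\}$, $\bar W=E$, $\bar E=W$. A vertex $v$ is an $X$-vertex if no edge $a$ has $\bar X(a)=v$; inner if neither. An edge $a$ is an $X$-edge if $X(a)$ is an $X$-vertex. $W$-$E$-functional: for every $X$-edge $a$ and edge $b\ne a$, $X(a)\ne X(b)$. Semipaths: $v_0a_1v_1\dots a_nv_n$ with $\{W(a_i),E(a_i)\}=\{v_{i-1},v_i\}$ and no repeated vertex; weakly connected: any two distinct vertices joined by a semipath; acyclic: no directed closed walk $v_0a_1\dots a_nv_n$ ($n\ge1$, $W(a_i)=v_{i-1}$, $E(a_i)=v_i$, vertices distinct except $v_0=v_n$). A D-graph is a finite, acyclic, $W$-$E$-functional, weakly connected graph with an inner vertex. For D-graphs $D_W=(W_W,E_W\colon A_W\to V_W)$, $D_E=(W_E,E_E\colon A_E\to V_E)$, the juncture $D_W\Box D_E$ is defined when $C=A_W\cap A_E\ne\emptyset$, $E_W(a)=W_E(a)$ for $a\in C$, each $a\in C$ is an $E$-edge of $D_W$ and a $W$-edge of $D_E$, and $V_W\cap V_E=V_C:=\{E_W(a)\mid a\in C\}$; it has edges $A_W\cup A_E$, vertices $(V_W\cup V_E)\setminus V_C$, $W(a)=W_W(a)$ if $a\in A_W$ else $W_E(a)$, $E(a)=E_E(a)$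 if $a\in A_E$ else $E_W(a)$. D-terms: fix an infinite set $\mathcal A$ of edge names. Basic D-terms are atomic symbols $\beta$, each assigned finite nonempty disjoint sets $W(\beta),E(\beta)\subseteq\mathcal A$ and $A(\beta)=W(\beta)\cup E(\beta)$. If $\delta_W,\delta_E$ are D-terms with $C:=A(\delta_W)\cap A(\delta_E)=E(\delta_W)\cap W(\delta_E)\neq\emptyset$, then $(\delta_W\Box\delta_E)$ is a D-term with $W(\delta_W\Box\delta_E)=W(\delta_W)\cup(W(\delta_E)\setminus C)$, $E(\delta_W\Box\delta_E)=E(\delta_E)\cup(E(\delta_W)\setminus C)$, $A(\delta_W\Box\delta_E)=A(\delta_W)\cup A(\delta_E)$. The triple $(W(\delta),E(\delta),A(\delta))$ is the edge type of $\delta$. The system S$\Box$ derives equations $\delta=\delta'$ between D-terms of the same edge type: axioms $\delta=\delta$ and, whenever both sides are D-terms, (Ass 1) $(\delta_1\Box\delta_2)\Box\delta_3=\delta_1\Box(\delta_2\Box\delta_3)$, (Ass 2.1) $(\delta_1\Box\delta_2)\Box\delta_3=(\delta_1\Box\delta_3)\Box\delta_2$, (Ass 2.2) $\delta_1\Box(\delta_2\Box\delta_3)=\delta_2\Box(\delta_1\Box\delta_3)$; rules: symmetry and transitivity of $=$, and from $\delta_1=\delta_2$ and $\delta_3=\delta_4$ infer $\delta_1\Box\delta_3=\delta_2\Box\delta_4$ provided both sides are D-terms. Interpretation $\iota$: fix injective assignments $e\mapsto v_e$ (edges of $\mathcal A$) and $\beta\mapsto v_\beta$ (basic D-terms) to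 pairwise distinct vertices not in $\mathcal A$. For a basic D-term $\beta$ with $W(\beta)=\{a_1,\dots,a_n\}$, $E(\beta)=\{b_1,\dots,b_m\}$, $\iota(\beta)$ is the graph with edges $a_i$ from $v_{a_i}$ to $v_\beta$ and $b_j$ from $v_\beta$ to $v_{b_j}$. Further $\iota(\delta_W\Box\delta_E)=\iota(\delta_W)\Box\iota(\delta_E)$ (juncture of D-graphs). *)

theory Defs
  imports "Graph_Theory.Arc_Walk" "HOL-Library.FuncSet"
begin

text \<open>
  A graph is a pair of functions \<open>W, E : A \<rightarrow> V\<close>; we use the digraph record with
  \<open>W = tail\<close> and \<open>E = head\<close>. Edges and vertices have different types, which accounts for
  the requirement that \<open>A\<close> and \<open>V\<close> be disjoint. Requiring the two functions to be
  extensional (\<open>undefined\<close> outside the edge set) makes equality of records coincide with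
  equality of graphs.
\<close>

definition is_graph :: "('v, 'a) pre_digraph \<Rightarrow> bool" where
  "is_graph G \<longleftrightarrow> tail G \<in> arcs G \<rightarrow>\<^sub>E verts G \<and> head G \<in> arcs G \<rightarrow>\<^sub>E verts G"

datatype side = West | East

fun opp :: "side \<Rightarrow> side" where
  "opp West = East"
| "opp East = West"

fun end_at :: "side \<Rightarrow> ('v, 'a) pre_digraph \<Rightarrow> 'a \<Rightarrow> 'v" where
  "end_at West G = tail G"
| "end_at East G = head G"

definition side_vertex :: "side \<Rightarrow> ('v, 'a) pre_digraph \<Rightarrow> 'v \<Rightarrow> bool" where
  "side_vertex X G v \<longleftrightarrow> v \<in> verts G \<and> \<not> (\<exists>a\<in>arcs G. end_at (opp X) G a = v)"

definition inner_vertex :: "('v, 'a) pre_digraph \<Rightarrow> 'v \<Rightarrow> bool" where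
  "inner_vertex G v \<longleftrightarrow> v \<in> verts G \<and> \<not> side_vertex West G v \<and> \<not> side_vertex East G v"

definition side_edge :: "side \<Rightarrow> ('v, 'a) pre_digraph \<Rightarrow> 'a \<Rightarrow> bool" where
  "side_edge X G a \<longleftrightarrow> a \<in> arcs G \<and> side_vertex X G (end_at X G a)"

definition WE_functional :: "('v, 'a) pre_digraph \<Rightarrow> bool" where
  "WE_functional G \<longleftrightarrow>
    (\<forall>X a b. side_edge X G a \<and> b \<in> arcs G \<and> b \<noteq> a \<longrightarrow> end_at X G a \<noteq> end_at X G b)"

text \<open>The semipath \<open>v\<^sub>0 a\<^sub>1 v\<^sub>1 \<dots> a\<^sub>n v\<^sub>n\<close> is given by its list of vertices and its list of edges.\<close>

definition semipath :: "('v, 'a) pre_digraph \<Rightarrow> 'v list \<Rightarrow> 'a list \<Rightarrow> bool" where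
  "semipath G vs es \<longleftrightarrow>
    length vs = Suc (length es) \<and> set vs \<subseteq> verts G \<and> set es \<subseteq> arcs G \<and> distinct vs \<and>
    (\<forall>i<length es. {tail G (es ! i), head G (es ! i)} = {vs ! i, vs ! Suc i})"

definition weakly_connected :: "('v, 'a) pre_digraph \<Rightarrow> bool" where
  "weakly_connected G \<longleftrightarrow>
    (\<forall>u\<in>verts G. \<forall>v\<in>verts G. u \<noteq> v \<longrightarrow>
      (\<exists>vs es. semipath G vs es \<and> hd vs = u \<and> last vs = v))"

definition acyclic_graph :: "('v, 'a) pre_digraph \<Rightarrow> bool" where
  "acyclic_graph G \<longleftrightarrow> \<not> (\<exists>p. pre_digraph.cycle G p)"

definition D_graph :: "('v, 'a) pre_digraph \<Rightarrow> bool" where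
  "D_graph G \<longleftrightarrow>
    is_graph G \<and> finite (verts G) \<and> finite (arcs G) \<and> acyclic_graph G \<and> WE_functional G \<and>
    weakly_connected G \<and> (\<exists>v. inner_vertex G v)"

definition juncture_defined :: "('v, 'a) pre_digraph \<Rightarrow> ('v, 'a) pre_digraph \<Rightarrow> bool" where
  "juncture_defined DW DE \<longleftrightarrow>
    (let C = arcs DW \<inter> arcs DE in
      D_graph DW \<and> D_graph DE \<and> C \<noteq> {} \<and>
      (\<forall>a\<in>C. head DW a = tail DE a) \<and>
      (\<forall>a\<in>C. side_edge East DW a \<and> side_edge West DE a) \<and>
      verts DW \<inter> verts DE = head DW ` C)"

text \<open>Juncture is a partial operation; \<open>None\<close> means that it is not defined.\<close>

definition juncture ::
    "('v, 'a) pre_digraph \<Rightarrow> ('v, 'a) pre_digraph \<Rightarrow> ('v, 'a) pre_digraph option" where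
  "juncture DW DE =
    (if juncture_defined DW DE then
       Some \<lparr>verts = (verts DW \<union> verts DE) - head DW ` (arcs DW \<inter> arcs DE),
             arcs = arcs DW \<union> arcs DE,
             tail = (\<lambda>a\<in>arcs DW \<union> arcs DE. if a \<in> arcs DW then tail DW a else tail DE a),
             head = (\<lambda>a\<in>arcs DW \<union> arcs DE. if a \<in> arcs DE then head DE a else head DW a)\<rparr>
     else None)"

text \<open>
  The elements of the type \<open>'b\<close> are the basic D-terms; \<open>Wb\<close> and \<open>Eb\<close> are their assigned sets
  of edge names. The datatype consists of raw expressions, among which \<open>is_dterm\<close> selects the
  D-terms.
\<close>

datatype 'b dexp = Basic 'b | Junc "'b dexp" "'b dexp" (infix "\<box>" 70)

fun At :: "('b \<Rightarrow> 'a set) \<Rightarrow> ('b \<Rightarrow> 'a set) \<Rightarrow> 'b dexp \<Rightarrow> 'a set" where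
  "At Wb Eb (Basic \<beta>) = Wb \<beta> \<union> Eb \<beta>"
| "At Wb Eb (\<delta>W \<box> \<delta>E) = At Wb Eb \<delta>W \<union> At Wb Eb \<delta>E"

fun Wt :: "('b \<Rightarrow> 'a set) \<Rightarrow> ('b \<Rightarrow> 'a set) \<Rightarrow> 'b dexp \<Rightarrow> 'a set" where
  "Wt Wb Eb (Basic \<beta>) = Wb \<beta>"
| "Wt Wb Eb (\<delta>W \<box> \<delta>E) =
    Wt Wb Eb \<delta>W \<union> (Wt Wb Eb \<delta>E - (At Wb Eb \<delta>W \<inter> At Wb Eb \<delta>E))"

fun Et :: "('b \<Rightarrow> 'a set) \<Rightarrow> ('b \<Rightarrow> 'a set) \<Rightarrow> 'b dexp \<Rightarrow> 'a set" where
  "Et Wb Eb (Basic \<beta>) = Eb \<beta>"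
| "Et Wb Eb (\<delta>W \<box> \<delta>E) =
    Et Wb Eb \<delta>E \<union> (Et Wb Eb \<delta>W - (At Wb Eb \<delta>W \<inter> At Wb Eb \<delta>E))"

fun is_dterm :: "('b \<Rightarrow> 'a set) \<Rightarrow> ('b \<Rightarrow> 'a set) \<Rightarrow> 'b dexp \<Rightarrow> bool" where
  "is_dterm Wb Eb (Basic \<beta>) = True"
| "is_dterm Wb Eb (\<delta>W \<box> \<delta>E) \<longleftrightarrow>
    is_dterm Wb Eb \<delta>W \<and> is_dterm Wb Eb \<delta>E \<and>
    At Wb Eb \<delta>W \<inter> At Wb Eb \<delta>E = Et Wb Eb \<delta>W \<inter> Wt Wb Eb \<delta>E \<and>
    Et Wb Eb \<delta>W \<inter> Wt Wb Eb \<delta>E \<noteq> {}"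

text \<open>
  If every \<open>Wb \<beta>\<close> is disjoint from \<open>Eb \<beta>\<close>, the two sides of a derivable equation automatically
  have the same edge type, so this is not imposed as a side condition.
\<close>

inductive derivable ::
    "('b \<Rightarrow> 'a set) \<Rightarrow> ('b \<Rightarrow> 'a set) \<Rightarrow> 'b dexp \<Rightarrow> 'b dexp \<Rightarrow> bool"
  for Wb Eb where
  refl: "is_dterm Wb Eb \<delta> \<Longrightarrow> derivable Wb Eb \<delta> \<delta>"
| ass_1: "\<lbrakk>is_dterm Wb Eb ((\<delta>\<^sub>1 \<box> \<delta>\<^sub>2) \<box> \<delta>\<^sub>3); is_dterm Wb Eb (\<delta>\<^sub>1 \<box> (\<delta>\<^sub>2 \<box> \<delta>\<^sub>3))\<rbrakk>
    \<Longrightarrow> derivable Wb Eb ((\<delta>\<^sub>1 \<box> \<delta>\<^sub>2) \<box> \<delta>\<^sub>3) (\<delta>\<^sub>1 \<box> (\<delta>\<^sub>2 \<box> \<delta>\<^sub>3))"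
| ass_2_1: "\<lbrakk>is_dterm Wb Eb ((\<delta>\<^sub>1 \<box> \<delta>\<^sub>2) \<box> \<delta>\<^sub>3); is_dterm Wb Eb ((\<delta>\<^sub>1 \<box> \<delta>\<^sub>3) \<box> \<delta>\<^sub>2)\<rbrakk>
    \<Longrightarrow> derivable Wb Eb ((\<delta>\<^sub>1 \<box> \<delta>\<^sub>2) \<box> \<delta>\<^sub>3) ((\<delta>\<^sub>1 \<box> \<delta>\<^sub>3) \<box> \<delta>\<^sub>2)"
| ass_2_2: "\<lbrakk>is_dterm Wb Eb (\<delta>\<^sub>1 \<box> (\<delta>\<^sub>2 \<box> \<delta>\<^sub>3)); is_dterm Wb Eb (\<delta>\<^sub>2 \<box> (\<delta>\<^sub>1 \<box> \<delta>\<^sub>3))\<rbrakk>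
    \<Longrightarrow> derivable Wb Eb (\<delta>\<^sub>1 \<box> (\<delta>\<^sub>2 \<box> \<delta>\<^sub>3)) (\<delta>\<^sub>2 \<box> (\<delta>\<^sub>1 \<box> \<delta>\<^sub>3))"
| sym: "derivable Wb Eb \<delta> \<delta>' \<Longrightarrow> derivable Wb Eb \<delta>' \<delta>"
| trans: "\<lbrakk>derivable Wb Eb \<delta> \<delta>'; derivable Wb Eb \<delta>' \<delta>''\<rbrakk> \<Longrightarrow> derivable Wb Eb \<delta> \<delta>''"
| cong: "\<lbrakk>derivable Wb Eb \<delta>\<^sub>1 \<delta>\<^sub>2; derivable Wb Eb \<delta>\<^sub>3 \<delta>\<^sub>4;
      is_dterm Wb Eb (\<delta>\<^sub>1 \<box> \<delta>\<^sub>3); is_dterm Wb Eb (\<delta>\<^sub>2 \<box> \<delta>\<^sub>4)\<rbrakk>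
    \<Longrightarrow> derivable Wb Eb (\<delta>\<^sub>1 \<box> \<delta>\<^sub>3) (\<delta>\<^sub>2 \<box> \<delta>\<^sub>4)"

text \<open>\<open>ve\<close> and \<open>vb\<close> are the assignments of vertices to edge names and to basic D-terms.\<close>

definition basic_graph ::
    "('b \<Rightarrow> 'a set) \<Rightarrow> ('b \<Rightarrow> 'a set) \<Rightarrow> ('a \<Rightarrow> 'v) \<Rightarrow> ('b \<Rightarrow> 'v) \<Rightarrow> 'b \<Rightarrow> ('v, 'a) pre_digraph"
  where
  "basic_graph Wb Eb ve vb \<beta> =
    \<lparr>verts = insert (vb \<beta>) (ve ` (Wb \<beta> \<union> Eb \<beta>)),
     arcs = Wb \<beta> \<union> Eb \<beta>,
     tail = (\<lambda>a\<in>Wb \<beta> \<union> Eb \<beta>. if a \<in> Wb \<beta> then ve a else vb \<beta>),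
     head = (\<lambda>a\<in>Wb \<beta> \<union> Eb \<beta>. if a \<in> Wb \<beta> then vb \<beta> else ve a)\<rparr>"

fun iota ::
    "('b \<Rightarrow> 'a set) \<Rightarrow> ('b \<Rightarrow> 'a set) \<Rightarrow> ('a \<Rightarrow> 'v) \<Rightarrow> ('b \<Rightarrow> 'v) \<Rightarrow> 'b dexp
      \<Rightarrow> ('v, 'a) pre_digraph option"
  where
  "iota Wb Eb ve vb (Basic \<beta>) = Some (basic_graph Wb Eb ve vb \<beta>)"
| "iota Wb Eb ve vb (\<delta>W \<box> \<delta>E) =
    Option.bind (iota Wb Eb ve vb \<delta>W)
      (\<lambda>DW. Option.bind (iota Wb Eb ve vb \<delta>E) (\<lambda>DE. juncture DW DE))"

end

theory Submission
  imports Defs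
begin

text \<open>
  The basic D-terms occurring in a D-term are distinct, and \<open>\<iota>(\<delta>)\<close> both determines and is
  determined by the set \<open>B\<close> of these. So the task is to derive \<open>\<delta> = \<delta>'\<close> whenever \<open>\<delta>\<close> and \<open>\<delta>'\<close>
  have the same \<open>B\<close>. Fix a source \<open>\<sigma>\<close> of \<open>B\<close> (the leftmost leaf of \<open>\<delta>\<close>) and another element
  \<open>\<pi>\<close>. The three associativity axioms suffice to bring every D-term over \<open>B\<close> to the form
  \<open>\<delta>\<^sub>1 \<box> \<delta>\<^sub>2\<close> where \<open>\<delta>\<^sub>2\<close> consists of the connected component of \<open>\<pi>\<close> in \<open>B - {\<sigma>}\<close>. As the
  parts of this cut depend only on \<open>B\<close>, induction on the size of \<open>B\<close> applies.
\<close>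

section \<open>Edge sets of D-terms\<close>

locale basic_dterms =
  fixes Wb Eb :: "'b \<Rightarrow> 'a set"
  assumes Wb_nonempty: "Wb \<beta> \<noteq> {}"
    and Eb_nonempty: "Eb \<beta> \<noteq> {}"
    and Wb_Eb_disjoint: "Wb \<beta> \<inter> Eb \<beta> = {}"
begin

text \<open>Unlike \<open>Wt\<close>, this keeps the edges used up by junctures, so it depends on
  the set of leaves only. The same holds for \<open>east\<close> and \<open>Et\<close>.\<close>

definition west :: "'b dexp \<Rightarrow> 'a set" where
  "west \<delta> = (\<Union>\<beta>\<in>set_dexp \<delta>. Wb \<beta>)"

definition east :: "'b dexp \<Rightarrow> 'a set" where
  "east \<delta> = (\<Union>\<beta>\<in>set_dexp \<delta>. Eb \<beta>)"

abbreviation "dterm \<equiv> is_dterm Wb Eb"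

abbreviation deriv :: "'b dexp \<Rightarrow> 'b dexp \<Rightarrow> bool" (infix "\<approx>" 50) where
  "deriv \<equiv> derivable Wb Eb"

lemma west_simps [simp]:
  "west (Basic \<beta>) = Wb \<beta>" "west (\<delta>\<^sub>1 \<box> \<delta>\<^sub>2) = west \<delta>\<^sub>1 \<union> west \<delta>\<^sub>2"
  by (auto simp: west_def)

lemma east_simps [simp]:
  "east (Basic \<beta>) = Eb \<beta>" "east (\<delta>\<^sub>1 \<box> \<delta>\<^sub>2) = east \<delta>\<^sub>1 \<union> east \<delta>\<^sub>2"
  by (auto simp: east_def)

lemma At_eq: "At Wb Eb \<delta> = west \<delta> \<union> east \<delta>"
  by (induction \<delta>) auto

text \<open>The edges \<open>C\<close> that a juncture takes away are exactly those that become both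
  an outgoing edge of one leaf and an incoming edge of another.\<close>

lemma Wt_Et_eq:
  "dterm \<delta> \<Longrightarrow> Wt Wb Eb \<delta> = west \<delta> - east \<delta> \<and> Et Wb Eb \<delta> = east \<delta> - west \<delta>"
proof (induction \<delta>)
  case (Basic \<beta>)
  then show ?case using Wb_Eb_disjoint[of \<beta>] by auto
next
  case (Junc \<delta>\<^sub>1 \<delta>\<^sub>2)
  then have eqs: "Wt Wb Eb \<delta>\<^sub>1 = west \<delta>\<^sub>1 - east \<delta>\<^sub>1" "Et Wb Eb \<delta>\<^sub>1 = east \<delta>\<^sub>1 - west \<delta>\<^sub>1"
     "Wt Wb Eb \<delta>\<^sub>2 = west \<delta>\<^sub>2 - east \<delta>\<^sub>2" "Et Wb Eb \<delta>\<^sub>2 = east \<delta>\<^sub>2 - west \<delta>\<^sub>2"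
    by auto
  have "(west \<delta>\<^sub>1 \<union> east \<delta>\<^sub>1) \<inter> (west \<delta>\<^sub>2 \<union> east \<delta>\<^sub>2) = (east \<delta>\<^sub>1 - west \<delta>\<^sub>1) \<inter> (west \<delta>\<^sub>2 - east \<delta>\<^sub>2)"
    using Junc.prems by (simp add: eqs At_eq)
  then show ?case unfolding Wt.simps Et.simps At_eq eqs west_simps east_simps by blast
qed

lemmas Wt_eq = Wt_Et_eq[THEN conjunct1] and Et_eq = Wt_Et_eq[THEN conjunct2]

text \<open>The factors may overlap only in edges that leave the left one and enter the right one,
  so the other three overlaps are empty. In this form the side conditions of the axioms become plain
  set algebra on leaves.\<close>

lemma dterm_Junc_iff:
  "dterm (\<delta>\<^sub>1 \<box> \<delta>\<^sub>2) \<longleftrightarrow> dterm \<delta>\<^sub>1 \<and> dterm \<delta>\<^sub>2 \<and> west \<delta>\<^sub>1 \<inter> west \<delta>\<^sub>2 = {} \<and> east \<delta>\<^sub>1 \<inter> east \<delta>\<^sub>2 = {} \<and>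
     west \<delta>\<^sub>1 \<inter> east \<delta>\<^sub>2 = {} \<and> east \<delta>\<^sub>1 \<inter> west \<delta>\<^sub>2 \<noteq> {}" (is "?L \<longleftrightarrow> ?R")
proof
  assume L: ?L
  then have d: "dterm \<delta>\<^sub>1" "dterm \<delta>\<^sub>2" by auto
  have "(west \<delta>\<^sub>1 \<union> east \<delta>\<^sub>1) \<inter> (west \<delta>\<^sub>2 \<union> east \<delta>\<^sub>2) = (east \<delta>\<^sub>1 - west \<delta>\<^sub>1) \<inter> (west \<delta>\<^sub>2 - east \<delta>\<^sub>2)"
    "(east \<delta>\<^sub>1 - west \<delta>\<^sub>1) \<inter> (west \<delta>\<^sub>2 - east \<delta>\<^sub>2) \<noteq> {}"
    using L d by (simp_all add: Wt_eq Et_eq At_eq)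
  then show ?R using d by blast
next
  assume R: ?R
  then have "(west \<delta>\<^sub>1 \<union> east \<delta>\<^sub>1) \<inter> (west \<delta>\<^sub>2 \<union> east \<delta>\<^sub>2) = (east \<delta>\<^sub>1 - west \<delta>\<^sub>1) \<inter> (west \<delta>\<^sub>2 - east \<delta>\<^sub>2)"
    "(east \<delta>\<^sub>1 - west \<delta>\<^sub>1) \<inter> (west \<delta>\<^sub>2 - east \<delta>\<^sub>2) \<noteq> {}"
    by blast+
  then show ?L using R by (simp add: Wt_eq Et_eq At_eq)
qed

declare is_dterm.simps(2) [simp del]

section \<open>Leaves of a D-term: invariance, disjointness, connectedness, sources, ranks\<close>

text \<open>Soundness at the level of leaves: every axiom only rearranges its three
  subterms.\<close>

lemma derivable_invariants:
  "\<delta> \<approx> \<delta>' \<Longrightarrow> dterm \<delta> \<and> dterm \<delta>' \<and> set_dexp \<delta> = set_dexp \<delta>'"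
  by (induction rule: derivable.induct) auto

lemma derivable_west_east: "\<delta> \<approx> \<delta>' \<Longrightarrow> west \<delta> = west \<delta>' \<and> east \<delta> = east \<delta>'"
  using derivable_invariants by (auto simp: west_def east_def)

lemma finite_set_dexp [simp]: "finite (set_dexp (\<delta> :: 'b dexp))"
  by (induction \<delta>) auto

lemma set_dexp_nonempty: "set_dexp (\<delta> :: 'b dexp) \<noteq> {}"
  by (induction \<delta>) auto

text \<open>A common leaf would put its nonempty \<open>Wb\<close> into \<open>west\<close> of both
  factors.\<close>

lemma dterm_Junc_disjoint:
  assumes "dterm (\<delta>\<^sub>1 \<box> \<delta>\<^sub>2)"
  shows "set_dexp \<delta>\<^sub>1 \<inter> set_dexp \<delta>\<^sub>2 = {}"
proof -
  have "west \<delta>\<^sub>1 \<inter> west \<delta>\<^sub>2 = {}" using assms by (simp add: dterm_Junc_iff)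
  then show ?thesis using Wb_nonempty unfolding west_def by blast
qed

text \<open>An edge enters at most one leaf. This and the dual fact for \<open>Eb\<close> make the
  ends of an edge in \<open>dgraph\<close> well defined.\<close>

lemma dterm_Wb_disjoint:
  "dterm \<delta> \<Longrightarrow> \<beta> \<in> set_dexp \<delta> \<Longrightarrow> \<gamma> \<in> set_dexp \<delta> \<Longrightarrow> a \<in> Wb \<beta> \<Longrightarrow> a \<in> Wb \<gamma> \<Longrightarrow> \<beta> = \<gamma>"
proof (induction \<delta>)
  case (Junc \<delta>\<^sub>1 \<delta>\<^sub>2)
  then have "west \<delta>\<^sub>1 \<inter> west \<delta>\<^sub>2 = {}" "dterm \<delta>\<^sub>1" "dterm \<delta>\<^sub>2" by (auto simp: dterm_Junc_iff)
  then show ?case using Junc by (auto simp: west_def)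
qed auto

lemma dterm_Eb_disjoint:
  "dterm \<delta> \<Longrightarrow> \<beta> \<in> set_dexp \<delta> \<Longrightarrow> \<gamma> \<in> set_dexp \<delta> \<Longrightarrow> a \<in> Eb \<beta> \<Longrightarrow> a \<in> Eb \<gamma> \<Longrightarrow> \<beta> = \<gamma>"
proof (induction \<delta>)
  case (Junc \<delta>\<^sub>1 \<delta>\<^sub>2)
  then have "east \<delta>\<^sub>1 \<inter> east \<delta>\<^sub>2 = {}" "dterm \<delta>\<^sub>1" "dterm \<delta>\<^sub>2" by (auto simp: dterm_Junc_iff)
  then show ?case using Junc by (auto simp: east_def)
qed auto

text \<open>Connectedness of the leaves as a closure principle: the edge shared by the factors of a
  juncture carries membership in \<open>K\<close> from one factor to the other.\<close>

lemma dterm_connected: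
  assumes "dterm \<delta>" "\<pi> \<in> set_dexp \<delta>" "\<pi> \<in> K"
    and "\<And>\<beta> \<gamma>. \<beta> \<in> set_dexp \<delta> \<Longrightarrow> \<gamma> \<in> set_dexp \<delta> \<Longrightarrow> Eb \<beta> \<inter> Wb \<gamma> \<noteq> {} \<Longrightarrow> \<beta> \<in> K \<longleftrightarrow> \<gamma> \<in> K"
  shows "set_dexp \<delta> \<subseteq> K"
  using assms
proof (induction \<delta> arbitrary: \<pi>)
  case (Junc \<delta>\<^sub>1 \<delta>\<^sub>2)
  have d: "dterm \<delta>\<^sub>1" "dterm \<delta>\<^sub>2" "east \<delta>\<^sub>1 \<inter> west \<delta>\<^sub>2 \<noteq> {}"
    using Junc.prems(1) by (auto simp: dterm_Junc_iff)
  then obtain \<beta> \<gamma> where e: "\<beta> \<in> set_dexp \<delta>\<^sub>1" "\<gamma> \<in> set_dexp \<delta>\<^sub>2" "Eb \<beta> \<inter> Wb \<gamma> \<noteq> {}"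
    unfolding west_def east_def by blast
  have "\<beta> \<in> K \<longleftrightarrow> \<gamma> \<in> K" using Junc.prems(4)[of \<beta> \<gamma>] e by simp
  moreover have "set_dexp \<delta>\<^sub>1 \<subseteq> K" if "\<pi>' \<in> set_dexp \<delta>\<^sub>1" "\<pi>' \<in> K" for \<pi>'
    by (rule Junc.IH(1)[OF d(1) that]) (rule Junc.prems(4), auto)
  moreover have "set_dexp \<delta>\<^sub>2 \<subseteq> K" if "\<pi>' \<in> set_dexp \<delta>\<^sub>2" "\<pi>' \<in> K" for \<pi>'
    by (rule Junc.IH(2)[OF d(2) that]) (rule Junc.prems(4), auto)
  ultimately show ?case using Junc.prems(2,3) e by auto
qed auto

text \<open>No edge runs from the right factor back to the left one, so a source of the left factor
  stays a source.\<close>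

lemma dterm_source:
  "dterm \<delta> \<Longrightarrow> \<exists>\<sigma>\<in>set_dexp \<delta>. Wb \<sigma> \<inter> east \<delta> = {}"
proof (induction \<delta>)
  case (Basic \<beta>)
  then show ?case using Wb_Eb_disjoint[of \<beta>] by auto
next
  case (Junc \<delta>\<^sub>1 \<delta>\<^sub>2)
  then obtain \<sigma> where "\<sigma> \<in> set_dexp \<delta>\<^sub>1" "Wb \<sigma> \<inter> east \<delta>\<^sub>1 = {}" by (auto simp: dterm_Junc_iff)
  moreover have "west \<delta>\<^sub>1 \<inter> east \<delta>\<^sub>2 = {}" using Junc.prems by (simp add: dterm_Junc_iff)
  ultimately show ?case unfolding west_def by (intro bexI[of _ \<sigma>]) auto
qed

text \<open>As edges between the factors run only from left to right, the ranks on the right factor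
  can be shifted above all ranks on the left one. This gives acyclicity later.\<close>

lemma dterm_rank:
  "dterm \<delta> \<Longrightarrow> \<exists>f :: 'b \<Rightarrow> nat. \<forall>\<beta>\<in>set_dexp \<delta>. \<forall>\<gamma>\<in>set_dexp \<delta>. Eb \<beta> \<inter> Wb \<gamma> \<noteq> {} \<longrightarrow> f \<beta> < f \<gamma>"
proof (induction \<delta>)
  case (Basic \<beta>)
  then show ?case using Wb_Eb_disjoint[of \<beta>] by auto
next
  case (Junc P Q)
  have d: "dterm P" "dterm Q" "west P \<inter> east Q = {}" "set_dexp P \<inter> set_dexp Q = {}"
    using Junc.prems dterm_Junc_disjoint by (auto simp: dterm_Junc_iff)
  then obtain f g :: "'b \<Rightarrow> nat" where
    f: "\<forall>\<beta>\<in>set_dexp P. \<forall>\<gamma>\<in>set_dexp P. Eb \<beta> \<inter> Wb \<gamma> \<noteq> {} \<longrightarrow> f \<beta> < f \<gamma>" and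
    g: "\<forall>\<beta>\<in>set_dexp Q. \<forall>\<gamma>\<in>set_dexp Q. Eb \<beta> \<inter> Wb \<gamma> \<noteq> {} \<longrightarrow> g \<beta> < g \<gamma>"
    using Junc.IH by blast
  define h where "h \<beta> = (if \<beta> \<in> set_dexp P then f \<beta> else Suc (Max (f ` set_dexp P) + g \<beta>))" for \<beta>
  have "h \<beta> < h \<gamma>"
    if "\<beta> \<in> set_dexp (P \<box> Q)" "\<gamma> \<in> set_dexp (P \<box> Q)" "Eb \<beta> \<inter> Wb \<gamma> \<noteq> {}" for \<beta> \<gamma>
  proof (cases "\<beta> \<in> set_dexp P")
    case True
    then have "f \<beta> < Suc (Max (f ` set_dexp P) + k)" for k
      by (intro le_imp_less_Suc trans_le_add1 Max_ge) auto
    then show ?thesis using True that f by (auto simp: h_def)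
  next
    case False
    then have "\<beta> \<in> set_dexp Q" "\<gamma> \<in> set_dexp Q - set_dexp P"
      using that d unfolding west_def east_def by fastforce+
    then show ?thesis using that False g by (auto simp: h_def)
  qed
  then show ?case by blast
qed

section \<open>Cutting off a component after the removal of a source\<close>

text \<open>For a source \<open>\<sigma>\<close>, the right factor consists of the connected component of \<open>\<pi>\<close> after the
  removal of \<open>\<sigma>\<close>: it is connected because it is a D-term.\<close>

definition splits :: "'b \<Rightarrow> 'b \<Rightarrow> 'b dexp \<Rightarrow> bool" where
  "splits \<sigma> \<pi> \<delta> \<longleftrightarrow> (\<exists>\<delta>\<^sub>1 \<delta>\<^sub>2. \<delta> \<approx> \<delta>\<^sub>1 \<box> \<delta>\<^sub>2 \<and> \<sigma> \<in> set_dexp \<delta>\<^sub>1 \<and> \<pi> \<in> set_dexp \<delta>\<^sub>2 \<and>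
     (\<forall>\<beta>\<in>set_dexp \<delta>\<^sub>1 - {\<sigma>}. Eb \<beta> \<inter> west \<delta>\<^sub>2 = {}))"

lemma splits_derivable: "\<delta> \<approx> \<delta>' \<Longrightarrow> splits \<sigma> \<pi> \<delta>' \<Longrightarrow> splits \<sigma> \<pi> \<delta>"
  unfolding splits_def by (meson derivable.trans)

text \<open>The side condition on the new juncture is automatic, since derivably equal terms have
  the same \<open>west\<close> and \<open>east\<close>.\<close>

lemma derivable_Junc_left:
  assumes "\<delta>\<^sub>1 \<approx> \<delta>\<^sub>1'" "dterm (\<delta>\<^sub>1 \<box> \<delta>\<^sub>2)"
  shows "\<delta>\<^sub>1 \<box> \<delta>\<^sub>2 \<approx> \<delta>\<^sub>1' \<box> \<delta>\<^sub>2"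
  using assms derivable_invariants[OF assms(1)] derivable_west_east[OF assms(1)]
  by (intro derivable.cong derivable.refl) (auto simp: dterm_Junc_iff)

lemma derivable_Junc_right:
  assumes "\<delta>\<^sub>2 \<approx> \<delta>\<^sub>2'" "dterm (\<delta>\<^sub>1 \<box> \<delta>\<^sub>2)"
  shows "\<delta>\<^sub>1 \<box> \<delta>\<^sub>2 \<approx> \<delta>\<^sub>1 \<box> \<delta>\<^sub>2'"
  using assms derivable_invariants[OF assms(1)] derivable_west_east[OF assms(1)]
  by (intro derivable.cong derivable.refl) (auto simp: dterm_Junc_iff)

text \<open>Pieces of \<open>P\<close> that are joined to \<open>Q\<close> move over to
  \<open>Q\<close> one by one, with the source staying in \<open>P\<close>. The left factor shrinks
  while the set of leaves is constant, hence the inner induction on \<open>P\<close>. The assumption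
  \<open>smaller\<close> stands for the outer induction hypothesis in \<open>dterm_splits\<close>
  and supplies the pieces.\<close>

lemma splits_source_left:
  assumes smaller: "\<And>\<delta> \<pi>. card (set_dexp \<delta>) < n \<Longrightarrow> dterm \<delta> \<Longrightarrow> \<sigma> \<in> set_dexp \<delta> \<Longrightarrow>
      Wb \<sigma> \<inter> east \<delta> = {} \<Longrightarrow> \<pi> \<in> set_dexp \<delta> - {\<sigma>} \<Longrightarrow> splits \<sigma> \<pi> \<delta>"
    and "dterm (P \<box> Q)" "card (set_dexp (P \<box> Q)) \<le> n" "\<sigma> \<in> set_dexp P"
    and "Wb \<sigma> \<inter> east (P \<box> Q) = {}" "\<pi> \<in> set_dexp (P \<box> Q) - {\<sigma>}"
  shows "splits \<sigma> \<pi> (P \<box> Q)"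
  using assms(2-)
proof (induction "card (set_dexp P)" arbitrary: P Q rule: less_induct)
  case less
  note disj = dterm_Junc_disjoint[OF less.prems(1)]
  have dPQ: "dterm P" "dterm Q" "west P \<inter> west Q = {}" "east P \<inter> east Q = {}"
     "west P \<inter> east Q = {}" "east P \<inter> west Q \<noteq> {}"
    using less.prems(1) by (auto simp: dterm_Junc_iff)
  show ?case
  proof (cases "\<pi> \<in> set_dexp Q \<and> (\<forall>\<beta>\<in>set_dexp P - {\<sigma>}. Eb \<beta> \<inter> west Q = {})")
    case True
    then show ?thesis unfolding splits_def using less.prems by (blast intro: derivable.refl)
  next
    case False
    text \<open>Split off from \<open>P\<close> the component of \<open>\<pi>\<close> or one that is joined to \<open>Q\<close>; if it is
      joined to \<open>Q\<close>, then \<open>Q\<close> absorbs it.\<close>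
    obtain \<rho> where \<rho>: "\<rho> \<in> set_dexp P - {\<sigma>}" "\<rho> = \<pi> \<or> \<pi> \<in> set_dexp Q \<and> Eb \<rho> \<inter> west Q \<noteq> {}"
      using False less.prems(5) by auto
    have "card (set_dexp P) < card (set_dexp (P \<box> Q))"
      using disj set_dexp_nonempty[of Q] by (intro psubset_card_mono) auto
    then have "splits \<sigma> \<rho> P"
      using smaller[of P \<rho>] less.prems \<rho> dPQ by auto
    then obtain P\<^sub>1 P\<^sub>2 where P: "P \<approx> P\<^sub>1 \<box> P\<^sub>2" "\<sigma> \<in> set_dexp P\<^sub>1" "\<rho> \<in> set_dexp P\<^sub>2"
      "\<forall>\<beta>\<in>set_dexp P\<^sub>1 - {\<sigma>}. Eb \<beta> \<inter> west P\<^sub>2 = {}"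
      unfolding splits_def by blast
    have d: "dterm (P\<^sub>1 \<box> P\<^sub>2)" "set_dexp P = set_dexp P\<^sub>1 \<union> set_dexp P\<^sub>2"
      using derivable_invariants[OF P(1)] by auto
    have we: "west P = west P\<^sub>1 \<union> west P\<^sub>2" "east P = east P\<^sub>1 \<union> east P\<^sub>2"
      using derivable_west_east[OF P(1)] by auto
    have d12: "dterm P\<^sub>1" "dterm P\<^sub>2" "west P\<^sub>1 \<inter> west P\<^sub>2 = {}" "east P\<^sub>1 \<inter> east P\<^sub>2 = {}"
       "west P\<^sub>1 \<inter> east P\<^sub>2 = {}" "east P\<^sub>1 \<inter> west P\<^sub>2 \<noteq> {}"
      using d(1) by (auto simp: dterm_Junc_iff)
    have step: "P \<box> Q \<approx> (P\<^sub>1 \<box> P\<^sub>2) \<box> Q"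
      using derivable_Junc_left[OF P(1) less.prems(1)] .
    then have dl: "dterm ((P\<^sub>1 \<box> P\<^sub>2) \<box> Q)" using derivable_invariants by blast
    show ?thesis
    proof (cases "east P\<^sub>2 \<inter> west Q = {}")
      case True
      then have "\<rho> = \<pi>" using \<rho> P(3) by (auto simp: east_def)
      \<comment> \<open>Some edge runs from \<open>P\<close> to \<open>Q\<close>; as none starts in
        \<open>P\<^sub>2\<close>, one starts in \<open>P\<^sub>1\<close>.\<close>
      have dr: "dterm ((P\<^sub>1 \<box> Q) \<box> P\<^sub>2)"
        using True dPQ d12 by (simp add: dterm_Junc_iff we Int_Un_distrib Int_Un_distrib2 Int_commute)
      have "P \<box> Q \<approx> (P\<^sub>1 \<box> Q) \<box> P\<^sub>2"
        using step derivable.ass_2_1[OF dl dr] by (rule derivable.trans)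
      \<comment> \<open>Nothing in \<open>Q\<close> feeds \<open>P\<^sub>2\<close>, because no edge
        leads from \<open>Q\<close> back into \<open>P\<close>.\<close>
      moreover have "\<forall>\<beta>\<in>set_dexp (P\<^sub>1 \<box> Q) - {\<sigma>}. Eb \<beta> \<inter> west P\<^sub>2 = {}"
        using P(4) dPQ(5) unfolding we by (auto simp: east_def)
      ultimately show ?thesis unfolding splits_def using P \<open>\<rho> = \<pi>\<close> by fastforce
    next
      case False
      have dr: "dterm (P\<^sub>1 \<box> (P\<^sub>2 \<box> Q))"
        using False dPQ d12 by (simp add: dterm_Junc_iff we Int_Un_distrib Int_Un_distrib2 Int_commute)
      have eq: "P \<box> Q \<approx> P\<^sub>1 \<box> (P\<^sub>2 \<box> Q)"
        using step derivable.ass_1[OF dl dr] by (rule derivable.trans)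
      have "card (set_dexp P\<^sub>1) < card (set_dexp P)"
        using d dterm_Junc_disjoint[OF d(1)] set_dexp_nonempty[of P\<^sub>2]
        by (intro psubset_card_mono) auto
      then have "splits \<sigma> \<pi> (P\<^sub>1 \<box> (P\<^sub>2 \<box> Q))"
        using less.hyps[of P\<^sub>1 "P\<^sub>2 \<box> Q"] less.prems dr P(2) d we by (simp add: Un_assoc)
      then show ?thesis using eq splits_derivable by blast
    qed
  qed
qed

text \<open>If \<sigma> lies in the right factor, that factor is cut by the induction hypothesis and
  its part containing \<sigma> is moved to the left; then \<open>splits_source_left\<close>
  applies.\<close>

lemma dterm_splits:
  assumes "dterm \<delta>" "\<sigma> \<in> set_dexp \<delta>" "Wb \<sigma> \<inter> east \<delta> = {}" "\<pi> \<in> set_dexp \<delta> - {\<sigma>}"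
  shows "splits \<sigma> \<pi> \<delta>"
  using assms
proof (induction "card (set_dexp \<delta>)" arbitrary: \<delta> \<pi> rule: less_induct)
  case less
  then obtain P Q where \<delta>: "\<delta> = P \<box> Q" by (cases \<delta>) auto
  have left: "splits \<sigma> \<pi> (P \<box> Q)" if "\<sigma> \<in> set_dexp P" and eq: "\<delta> \<approx> P \<box> Q" for P Q
  proof (rule splits_source_left)
    show "card (set_dexp (P \<box> Q)) \<le> card (set_dexp \<delta>)"
      using derivable_invariants[OF eq] by simp
    show "dterm (P \<box> Q)" "Wb \<sigma> \<inter> east (P \<box> Q) = {}" "\<pi> \<in> set_dexp (P \<box> Q) - {\<sigma>}"
      using less.prems derivable_invariants[OF eq] derivable_west_east[OF eq] by argo+
  qed (use that less.hyps in blast)+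
  have dPQ: "dterm P" "dterm Q" "west P \<inter> west Q = {}" "east P \<inter> east Q = {}"
     "west P \<inter> east Q = {}" "east P \<inter> west Q \<noteq> {}"
    using less.prems(1) \<delta> by (auto simp: dterm_Junc_iff)
  show ?case
  proof (cases "\<sigma> \<in> set_dexp P")
    case True
    then show ?thesis using left derivable.refl less.prems(1) unfolding \<delta> by blast
  next
    case False
    then have \<sigma>: "\<sigma> \<in> set_dexp Q" using less.prems \<delta> by auto
    \<comment> \<open>The edge from \<open>P\<close> to \<open>Q\<close> cannot enter the source
      \<sigma>, so \<open>Q\<close> has a second leaf and can be cut.\<close>
    have "east P \<inter> Wb \<sigma> = {}" using less.prems(3) \<delta> by auto
    then obtain \<rho> where \<rho>: "\<rho> \<in> set_dexp Q - {\<sigma>}"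
      using dPQ(6) unfolding west_def by fastforce
    have "card (set_dexp Q) < card (set_dexp \<delta>)"
      using dterm_Junc_disjoint less.prems(1) set_dexp_nonempty[of P] \<delta>
      by (intro psubset_card_mono) fastforce+
    then have "splits \<sigma> \<rho> Q"
      using less.hyps[of Q \<rho>] less.prems \<rho> \<sigma> dPQ \<delta> by auto
    then obtain Q\<^sub>1 Q\<^sub>2 where Q: "Q \<approx> Q\<^sub>1 \<box> Q\<^sub>2" "\<sigma> \<in> set_dexp Q\<^sub>1"
      unfolding splits_def by blast
    have d: "dterm (Q\<^sub>1 \<box> Q\<^sub>2)" "set_dexp Q = set_dexp Q\<^sub>1 \<union> set_dexp Q\<^sub>2"
      using derivable_invariants[OF Q(1)] by auto
    have we: "west Q = west Q\<^sub>1 \<union> west Q\<^sub>2" "east Q = east Q\<^sub>1 \<union> east Q\<^sub>2"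
      using derivable_west_east[OF Q(1)] by auto
    have d12: "dterm Q\<^sub>1" "dterm Q\<^sub>2" "west Q\<^sub>1 \<inter> west Q\<^sub>2 = {}" "east Q\<^sub>1 \<inter> east Q\<^sub>2 = {}"
       "west Q\<^sub>1 \<inter> east Q\<^sub>2 = {}" "east Q\<^sub>1 \<inter> west Q\<^sub>2 \<noteq> {}"
      using d(1) by (auto simp: dterm_Junc_iff)
    have step: "\<delta> \<approx> P \<box> (Q\<^sub>1 \<box> Q\<^sub>2)"
      using derivable_Junc_right[OF Q(1)] less.prems(1) \<delta> by simp
    then have dl: "dterm (P \<box> (Q\<^sub>1 \<box> Q\<^sub>2))" using derivable_invariants by blast
    obtain P' Q' where eq: "\<delta> \<approx> P' \<box> Q'" and \<sigma>': "\<sigma> \<in> set_dexp P'"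
    proof (cases "east P \<inter> west Q\<^sub>1 = {}")
      case True
      \<comment> \<open>The edge from \<open>P\<close> into \<open>Q\<close> must now enter
        \<open>Q\<^sub>2\<close>, so \<open>P\<close> and \<open>Q\<^sub>2\<close> can be
        joined.\<close>
      have dr: "dterm (Q\<^sub>1 \<box> (P \<box> Q\<^sub>2))"
        using True dPQ d12 by (simp add: dterm_Junc_iff we Int_Un_distrib Int_Un_distrib2 Int_commute)
      have "\<delta> \<approx> Q\<^sub>1 \<box> (P \<box> Q\<^sub>2)"
        using step derivable.ass_2_2[OF dl dr] by (rule derivable.trans)
      then show ?thesis using that Q(2) by blast
    next
      case False
      \<comment> \<open>Here \<open>P\<close> is joined to \<open>Q\<^sub>1\<close> directly, so
        (Ass 1) is read from right to left.\<close>
      have dr: "dterm ((P \<box> Q\<^sub>1) \<box> Q\<^sub>2)"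
        using False dPQ d12 by (simp add: dterm_Junc_iff we Int_Un_distrib Int_Un_distrib2 Int_commute)
      have "\<delta> \<approx> (P \<box> Q\<^sub>1) \<box> Q\<^sub>2"
        using step derivable.sym[OF derivable.ass_1[OF dr dl]] by (rule derivable.trans)
      then show ?thesis using that[of "P \<box> Q\<^sub>1" Q\<^sub>2] Q(2) by simp
    qed
    show ?thesis using left[OF \<sigma>' eq] eq splits_derivable by blast
  qed
qed

section \<open>Uniqueness of the cut and completeness\<close>

text \<open>\<open>Q'\<close> is connected and avoids \<sigma>, and no edge between leaves other
  than \<sigma> crosses the border of \<open>Q\<close> in either direction. So \<open>Q'\<close>,
  which meets \<open>Q\<close> in \<pi>, cannot leave it.\<close>

lemma component_subset:
  assumes "dterm (P \<box> Q)" "dterm (P' \<box> Q')" "set_dexp (P \<box> Q) = set_dexp (P' \<box> Q')"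
    and "\<sigma> \<in> set_dexp P'" "\<pi> \<in> set_dexp Q" "\<pi> \<in> set_dexp Q'"
    and closed: "\<forall>\<beta>\<in>set_dexp P - {\<sigma>}. Eb \<beta> \<inter> west Q = {}"
  shows "set_dexp Q' \<subseteq> set_dexp Q"
proof (rule dterm_connected)
  show "dterm Q'" using assms by (simp add: dterm_Junc_iff)
  fix \<beta> \<gamma>
  assume *: "\<beta> \<in> set_dexp Q'" "\<gamma> \<in> set_dexp Q'" "Eb \<beta> \<inter> Wb \<gamma> \<noteq> {}"
  have "west P \<inter> east Q = {}" using assms(1) by (simp add: dterm_Junc_iff)
  moreover have "\<sigma> \<notin> set_dexp Q'" using dterm_Junc_disjoint[OF assms(2)] assms(4) by auto
  moreover have "set_dexp Q' \<subseteq> set_dexp P \<union> set_dexp Q" using assms(3) by auto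
  ultimately show "\<beta> \<in> set_dexp Q \<longleftrightarrow> \<gamma> \<in> set_dexp Q"
    using * closed unfolding west_def east_def by blast
qed (use assms in auto)

text \<open>Both terms are cut at the same \<sigma> and \<pi>. The cuts have the same leaf sets by
  \<open>component_subset\<close> used both ways, and congruence joins the derivations for the
  smaller factors.\<close>

lemma derivable_if_set_dexp_eq:
  assumes "dterm \<delta>" "dterm \<delta>'" "set_dexp \<delta> = set_dexp \<delta>'"
  shows "\<delta> \<approx> \<delta>'"
  using assms
proof (induction "card (set_dexp \<delta>)" arbitrary: \<delta> \<delta>' rule: less_induct)
  case less
  obtain \<sigma> where \<sigma>: "\<sigma> \<in> set_dexp \<delta>" "Wb \<sigma> \<inter> east \<delta> = {}"
    using dterm_source less.prems by blast
  show ?case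
  proof (cases "set_dexp \<delta> = {\<sigma>}")
    case True
    \<comment> \<open>The factors of a juncture would be nonempty and disjoint, which a single leaf
      does not allow.\<close>
    have basic: "\<epsilon> = Basic \<sigma>" if "dterm \<epsilon>" "set_dexp \<epsilon> = {\<sigma>}" for \<epsilon>
    proof (cases \<epsilon>)
      case (Junc P Q)
      then have "set_dexp P \<union> set_dexp Q = {\<sigma>}" using that by simp
      then have "set_dexp P = {\<sigma>}" "set_dexp Q = {\<sigma>}"
        using set_dexp_nonempty[of P] set_dexp_nonempty[of Q] by (simp_all add: Un_singleton_iff)
      then show ?thesis using dterm_Junc_disjoint[of P Q] that(1) Junc by simp
    qed (use that in auto)
    have "\<delta> = \<delta>'" using basic[of \<delta>] basic[of \<delta>'] True less.prems by auto
    then show ?thesis using less.prems by (auto intro: derivable.refl)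
  next
    case False
    then obtain \<pi> where \<pi>: "\<pi> \<in> set_dexp \<delta> - {\<sigma>}" using \<sigma> by blast
    \<comment> \<open>The source chosen for \<delta> is thus also a source for \<delta>'.\<close>
    have "east \<delta>' = east \<delta>" using less.prems by (simp add: east_def)
    then have "splits \<sigma> \<pi> \<delta>" "splits \<sigma> \<pi> \<delta>'"
      using dterm_splits less.prems \<sigma> \<pi> by auto
    then obtain P Q P' Q' where
      PQ: "\<delta> \<approx> P \<box> Q" "\<sigma> \<in> set_dexp P" "\<pi> \<in> set_dexp Q"
        "\<forall>\<beta>\<in>set_dexp P - {\<sigma>}. Eb \<beta> \<inter> west Q = {}" and
      PQ': "\<delta>' \<approx> P' \<box> Q'" "\<sigma> \<in> set_dexp P'" "\<pi> \<in> set_dexp Q'"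
        "\<forall>\<beta>\<in>set_dexp P' - {\<sigma>}. Eb \<beta> \<inter> west Q' = {}"
      unfolding splits_def by blast
    have d: "dterm (P \<box> Q)" "dterm (P' \<box> Q')"
      using derivable_invariants PQ(1) PQ'(1) by auto
    have eq: "set_dexp (P \<box> Q) = set_dexp \<delta>" "set_dexp (P' \<box> Q') = set_dexp \<delta>"
      using derivable_invariants[OF PQ(1)] derivable_invariants[OF PQ'(1)] less.prems by auto
    have Q: "set_dexp Q = set_dexp Q'"
      using component_subset[OF d(1,2)] component_subset[OF d(2,1)] eq PQ PQ' by blast
    have disj: "set_dexp P \<inter> set_dexp Q = {}" "set_dexp P' \<inter> set_dexp Q' = {}"
      using d dterm_Junc_disjoint by blast+
    then have P: "set_dexp P = set_dexp P'" using Q eq by auto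
    have "card (set_dexp P) < card (set_dexp \<delta>)" "card (set_dexp Q) < card (set_dexp \<delta>)"
      using disj eq(1) set_dexp_nonempty[of P] set_dexp_nonempty[of Q]
      by (auto intro!: psubset_card_mono)
    then have "P \<approx> P'" "Q \<approx> Q'"
      using less.hyps P Q d unfolding dterm_Junc_iff by blast+
    then have "P \<box> Q \<approx> P' \<box> Q'" using d by (intro derivable.cong)
    then show ?thesis using PQ(1) PQ'(1) by (meson derivable.sym derivable.trans)
  qed
qed

lemma derivable_iff_set_dexp_eq:
  "dterm \<delta> \<Longrightarrow> dterm \<delta>' \<Longrightarrow> \<delta> \<approx> \<delta>' \<longleftrightarrow> set_dexp \<delta> = set_dexp \<delta>'"
  using derivable_if_set_dexp_eq derivable_invariants by blast

end

section \<open>Criteria for weak connectedness and acyclicity\<close>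

text \<open>Semipaths may not repeat a vertex: if \<open>w\<close> has been visited, the semipath is
  cut back to \<open>w\<close> instead of being extended.\<close>

lemma semipath_step:
  assumes sp: "semipath G vs es" and a: "a \<in> arcs G" "{tail G a, head G a} = {last vs, w}"
    and w: "w \<in> verts G"
  shows "\<exists>vs' es'. semipath G vs' es' \<and> hd vs' = hd vs \<and> last vs' = w"
proof (cases "w \<in> set vs")
  case True
  then obtain i where i: "i < length vs" "vs ! i = w" by (auto simp: in_set_conv_nth)
  have "semipath G (take (Suc i) vs) (take i es)"
    using sp i unfolding semipath_def by (auto dest: in_set_takeD)
  moreover have "hd (take (Suc i) vs) = hd vs" by (simp add: hd_take)
  moreover have "last (take (Suc i) vs) = w" using i by (simp add: take_Suc_conv_app_nth)
  ultimately show ?thesis by blast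
next
  case False
  have len: "length vs = Suc (length es)" using sp by (simp add: semipath_def)
  then have "vs \<noteq> []" by auto
  then have vs: "vs \<noteq> []" "last vs = vs ! length es" using len by (simp_all add: last_conv_nth)
  have "semipath G (vs @ [w]) (es @ [a])"
    using sp a w False vs len unfolding semipath_def by (auto simp: nth_append less_Suc_eq)
  moreover have "hd (vs @ [w]) = hd vs" "last (vs @ [w]) = w" using vs by auto
  ultimately show ?thesis by blast
qed

text \<open>The unordered pairs forget direction, so weak connectedness becomes reachability in the
  reflexive transitive closure.\<close>

definition adjacency :: "('v, 'a) pre_digraph \<Rightarrow> ('v \<times> 'v) set" where
  "adjacency G = {(u, v). \<exists>a\<in>arcs G. {tail G a, head G a} = {u, v}}"

lemma adjacencyI:
  "a \<in> arcs G \<Longrightarrow> (tail G a, head G a) \<in> adjacency G"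
  "a \<in> arcs G \<Longrightarrow> (head G a, tail G a) \<in> adjacency G"
  by (auto simp: adjacency_def)

lemma rtrancl_adjacency_semipath:
  assumes "is_graph G" "(u, v) \<in> (adjacency G)\<^sup>*" "u \<in> verts G"
  shows "\<exists>vs es. semipath G vs es \<and> hd vs = u \<and> last vs = v"
  using assms(2)
proof (induction rule: rtrancl_induct)
  case base
  have "semipath G [u] []" using assms(3) by (simp add: semipath_def)
  then show ?case by force
next
  case (step v w)
  then obtain vs es a where sp: "semipath G vs es" "hd vs = u" "last vs = v"
    and a: "a \<in> arcs G" "{tail G a, head G a} = {v, w}"
    by (auto simp: adjacency_def)
  have "tail G a \<in> verts G" "head G a \<in> verts G"
    using assms(1) a(1) unfolding is_graph_def by auto
  then have "w \<in> verts G" using a(2) by (auto simp: doubleton_eq_iff)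
  then show ?case using semipath_step[OF sp(1) a(1)] a(2) sp by auto
qed

text \<open>Adjacency is symmetric, so any two vertices are connected through
  \<open>x\<close>.\<close>

lemma weakly_connectedI:
  assumes "is_graph G" "\<And>v. v \<in> verts G \<Longrightarrow> (x, v) \<in> (adjacency G)\<^sup>*"
  shows "weakly_connected G"
proof -
  have "sym (adjacency G)" unfolding sym_def adjacency_def by (auto simp: insert_commute)
  then have "sym ((adjacency G)\<^sup>*)" by (rule sym_rtrancl)
  then have "(u, v) \<in> (adjacency G)\<^sup>*" if "u \<in> verts G" "v \<in> verts G" for u v
    using assms(2) that by (meson rtrancl_trans symD)
  then show ?thesis
    unfolding weakly_connected_def using rtrancl_adjacency_semipath[OF assms(1)] by blast
qed

text \<open>Along a walk \<open>f\<close> grows by at least the number of edges, so no nonempty walk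
  is closed.\<close>

lemma acyclic_graphI:
  fixes f :: "'v \<Rightarrow> nat"
  assumes f: "\<And>a. a \<in> arcs G \<Longrightarrow> f (tail G a) < f (head G a)"
  shows "acyclic_graph G"
proof -
  have le: "f u + length p \<le> f v" if "pre_digraph.cas G u p v" "set p \<subseteq> arcs G" for u p v
    using that
  proof (induction p arbitrary: u)
    case (Cons a p)
    then have "f (head G a) + length p \<le> f v" "f u < f (head G a)"
      using f[of a] by (auto simp: pre_digraph.cas.simps)
    then show ?case by simp
  qed (simp add: pre_digraph.cas.simps)
  have "\<not> pre_digraph.cycle G p" for p
  proof
    assume "pre_digraph.cycle G p"
    then obtain u where "pre_digraph.cas G u p u" "set p \<subseteq> arcs G" "p \<noteq> []"
      by (auto simp: pre_digraph.cycle_def pre_digraph.awalk_def)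
    then show False using le[of u p u] by simp
  qed
  then show ?thesis by (simp add: acyclic_graph_def)
qed

section \<open>The graph of a D-term in closed form\<close>

locale interpreted_dterms = basic_dterms Wb Eb for Wb Eb :: "'b \<Rightarrow> 'a set" +
  fixes \<A> :: "'a set" and ve :: "'a \<Rightarrow> 'v" and vb :: "'b \<Rightarrow> 'v"
  assumes finite_Wb: "finite (Wb \<beta>)" and finite_Eb: "finite (Eb \<beta>)"
    and Wb_subset: "Wb \<beta> \<subseteq> \<A>" and Eb_subset: "Eb \<beta> \<subseteq> \<A>"
    and inj_ve: "inj_on ve \<A>" and inj_vb: "inj vb"
    and ve_vb_disjoint: "ve ` \<A> \<inter> range vb = {}"
begin

text \<open>The intended value of \<open>iota\<close>, written in terms of the leaf set alone. An
  edge in both \<open>west\<close> and \<open>east\<close> joins two leaf vertices; only the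
  remaining edges keep their own vertex \<open>ve a\<close>.\<close>

definition dgraph :: "'b dexp \<Rightarrow> ('v, 'a) pre_digraph" where
  "dgraph \<delta> =
    \<lparr>verts = vb ` set_dexp \<delta> \<union> ve ` ((west \<delta> - east \<delta>) \<union> (east \<delta> - west \<delta>)),
     arcs = west \<delta> \<union> east \<delta>,
     tail = (\<lambda>a\<in>west \<delta> \<union> east \<delta>.
       if a \<in> east \<delta> then vb (THE \<beta>. \<beta> \<in> set_dexp \<delta> \<and> a \<in> Eb \<beta>) else ve a),
     head = (\<lambda>a\<in>west \<delta> \<union> east \<delta>.
       if a \<in> west \<delta> then vb (THE \<beta>. \<beta> \<in> set_dexp \<delta> \<and> a \<in> Wb \<beta>) else ve a)\<rparr>"

lemma verts_dgraph [simp]: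
  "verts (dgraph \<delta>) = vb ` set_dexp \<delta> \<union> ve ` ((west \<delta> - east \<delta>) \<union> (east \<delta> - west \<delta>))"
  and arcs_dgraph [simp]: "arcs (dgraph \<delta>) = west \<delta> \<union> east \<delta>"
  by (simp_all add: dgraph_def)

lemma dgraph_undefined:
  "a \<notin> west \<delta> \<union> east \<delta> \<Longrightarrow> tail (dgraph \<delta>) a = undefined \<and> head (dgraph \<delta>) a = undefined"
  by (simp add: dgraph_def)

lemma tail_dgraph:
  assumes "dterm \<delta>"
  shows "\<beta> \<in> set_dexp \<delta> \<Longrightarrow> a \<in> Eb \<beta> \<Longrightarrow> tail (dgraph \<delta>) a = vb \<beta>"
    and "a \<in> west \<delta> \<Longrightarrow> a \<notin> east \<delta> \<Longrightarrow> tail (dgraph \<delta>) a = ve a"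
proof -
  assume *: "\<beta> \<in> set_dexp \<delta>" "a \<in> Eb \<beta>"
  then have "(THE \<beta>. \<beta> \<in> set_dexp \<delta> \<and> a \<in> Eb \<beta>) = \<beta>"
    using dterm_Eb_disjoint[OF assms] by blast
  then show "tail (dgraph \<delta>) a = vb \<beta>" using * by (auto simp: dgraph_def east_def)
qed (simp add: dgraph_def)

lemma head_dgraph:
  assumes "dterm \<delta>"
  shows "\<beta> \<in> set_dexp \<delta> \<Longrightarrow> a \<in> Wb \<beta> \<Longrightarrow> head (dgraph \<delta>) a = vb \<beta>"
    and "a \<in> east \<delta> \<Longrightarrow> a \<notin> west \<delta> \<Longrightarrow> head (dgraph \<delta>) a = ve a"
proof -
  assume *: "\<beta> \<in> set_dexp \<delta>" "a \<in> Wb \<beta>"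
  then have "(THE \<beta>. \<beta> \<in> set_dexp \<delta> \<and> a \<in> Wb \<beta>) = \<beta>"
    using dterm_Wb_disjoint[OF assms] by blast
  then show "head (dgraph \<delta>) a = vb \<beta>" using * by (auto simp: dgraph_def west_def)
qed (simp add: dgraph_def)

lemma eastE:
  assumes "a \<in> east \<delta>"
  obtains \<beta> where "\<beta> \<in> set_dexp \<delta>" "a \<in> Eb \<beta>"
  using assms by (auto simp: east_def)

lemma westE:
  assumes "a \<in> west \<delta>"
  obtains \<beta> where "\<beta> \<in> set_dexp \<delta>" "a \<in> Wb \<beta>"
  using assms by (auto simp: west_def)

lemma tail_dgraph_cases:
  assumes "dterm \<delta>" "a \<in> west \<delta> \<union> east \<delta>"
  obtains \<beta> where "a \<in> east \<delta>" "\<beta> \<in> set_dexp \<delta>" "a \<in> Eb \<beta>" "tail (dgraph \<delta>) a = vb \<beta>"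
    | "a \<in> west \<delta>" "a \<notin> east \<delta>" "tail (dgraph \<delta>) a = ve a"
  using tail_dgraph[OF assms(1)] assms(2) by (metis UnE eastE)

lemma head_dgraph_cases:
  assumes "dterm \<delta>" "a \<in> west \<delta> \<union> east \<delta>"
  obtains \<beta> where "a \<in> west \<delta>" "\<beta> \<in> set_dexp \<delta>" "a \<in> Wb \<beta>" "head (dgraph \<delta>) a = vb \<beta>"
    | "a \<in> east \<delta>" "a \<notin> west \<delta>" "head (dgraph \<delta>) a = ve a"
  using head_dgraph[OF assms(1)] assms(2) by (metis UnE westE)

lemma west_subset: "west \<delta> \<subseteq> \<A>" and east_subset: "east \<delta> \<subseteq> \<A>"
  using Wb_subset Eb_subset by (auto simp: west_def east_def)

lemma ve_neq_vb: "a \<in> west \<delta> \<union> east \<delta> \<Longrightarrow> ve a \<noteq> vb \<beta> \<and> vb \<beta> \<noteq> ve a"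
  using ve_vb_disjoint west_subset east_subset by fastforce

lemma ve_eq_iff:
  "a \<in> west \<delta> \<union> east \<delta> \<Longrightarrow> b \<in> west \<epsilon> \<union> east \<epsilon> \<Longrightarrow> ve a = ve b \<longleftrightarrow> a = b"
  using inj_ve west_subset east_subset by (auto simp: inj_on_eq_iff subset_iff)

section \<open>The closed form is a D-graph\<close>

lemma is_graph_dgraph:
  assumes "dterm \<delta>"
  shows "is_graph (dgraph \<delta>)"
proof -
  have "tail (dgraph \<delta>) a \<in> verts (dgraph \<delta>)" if "a \<in> west \<delta> \<union> east \<delta>" for a
    using assms that by (rule tail_dgraph_cases) auto
  moreover have "head (dgraph \<delta>) a \<in> verts (dgraph \<delta>)" if "a \<in> west \<delta> \<union> east \<delta>" for a
    using assms that by (rule head_dgraph_cases) auto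
  ultimately show ?thesis
    using dgraph_undefined[of _ \<delta>] unfolding is_graph_def by (auto simp: PiE_def extensional_def)
qed

text \<open>\<open>Wb\<close> and \<open>Eb\<close> are nonempty, so edges both enter and leave
  every leaf vertex.\<close>

lemma not_side_vertex_vb:
  assumes "dterm \<delta>" "\<beta> \<in> set_dexp \<delta>"
  shows "\<not> side_vertex X (dgraph \<delta>) (vb \<beta>)"
proof -
  obtain a b where ab: "a \<in> Wb \<beta>" "b \<in> Eb \<beta>" using Wb_nonempty Eb_nonempty by blast
  then have "head (dgraph \<delta>) a = vb \<beta>" "tail (dgraph \<delta>) b = vb \<beta>" "a \<in> west \<delta>" "b \<in> east \<delta>"
    using assms tail_dgraph head_dgraph by (auto simp: west_def east_def)
  then show ?thesis by (cases X) (auto simp: side_vertex_def)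
qed

text \<open>By injectivity \<open>ve a\<close> is an end of \<open>a\<close> only, and leaf vertices
  are never side vertices.\<close>

lemma side_edge_dgraph_iff:
  assumes "dterm \<delta>"
  shows "side_edge West (dgraph \<delta>) a \<longleftrightarrow> a \<in> west \<delta> - east \<delta>"
    and "side_edge East (dgraph \<delta>) a \<longleftrightarrow> a \<in> east \<delta> - west \<delta>"
proof -
  have "side_vertex West (dgraph \<delta>) (ve a)" if "a \<in> west \<delta> - east \<delta>"
  proof -
    have "head (dgraph \<delta>) b \<noteq> ve a" if "b \<in> west \<delta> \<union> east \<delta>" for b
      using assms that
      by (rule head_dgraph_cases)
        (use \<open>a \<in> west \<delta> - east \<delta>\<close> ve_neq_vb[of a \<delta>] ve_eq_iff[of b \<delta> a \<delta>] in auto)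
    then show ?thesis using that by (auto simp: side_vertex_def)
  qed
  then show "side_edge West (dgraph \<delta>) a \<longleftrightarrow> a \<in> west \<delta> - east \<delta>"
    using tail_dgraph(1)[OF assms, of _ a] tail_dgraph(2)[OF assms, of a] not_side_vertex_vb[OF assms]
    by (auto simp: side_edge_def elim!: eastE)
  have "side_vertex East (dgraph \<delta>) (ve a)" if "a \<in> east \<delta> - west \<delta>"
  proof -
    have "tail (dgraph \<delta>) b \<noteq> ve a" if "b \<in> west \<delta> \<union> east \<delta>" for b
      using assms that
      by (rule tail_dgraph_cases)
        (use \<open>a \<in> east \<delta> - west \<delta>\<close> ve_neq_vb[of a \<delta>] ve_eq_iff[of b \<delta> a \<delta>] in auto)
    then show ?thesis using that by (auto simp: side_vertex_def)
  qed
  then show "side_edge East (dgraph \<delta>) a \<longleftrightarrow> a \<in> east \<delta> - west \<delta>"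
    using head_dgraph(1)[OF assms, of _ a] head_dgraph(2)[OF assms, of a] not_side_vertex_vb[OF assms]
    by (auto simp: side_edge_def elim!: westE)
qed

lemma WE_functional_dgraph:
  assumes "dterm \<delta>"
  shows "WE_functional (dgraph \<delta>)"
proof -
  have "end_at X (dgraph \<delta>) a \<noteq> end_at X (dgraph \<delta>) b"
    if *: "side_edge X (dgraph \<delta>) a" "b \<in> west \<delta> \<union> east \<delta>" "b \<noteq> a" for X a b
  proof (cases X)
    case West
    then have a: "a \<in> west \<delta> - east \<delta>" using * side_edge_dgraph_iff[OF assms] by simp
    then have "tail (dgraph \<delta>) a = ve a" using tail_dgraph(2)[OF assms] by auto
    moreover have "tail (dgraph \<delta>) b \<noteq> ve a"
      using assms *(2)
      by (rule tail_dgraph_cases) (use a *(2,3) ve_neq_vb[of a \<delta>] ve_eq_iff[of b \<delta> a \<delta>] in auto)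
    ultimately show ?thesis using West by simp
  next
    case East
    then have a: "a \<in> east \<delta> - west \<delta>" using * side_edge_dgraph_iff[OF assms] by simp
    then have "head (dgraph \<delta>) a = ve a" using head_dgraph(2)[OF assms] by auto
    moreover have "head (dgraph \<delta>) b \<noteq> ve a"
      using assms *(2)
      by (rule head_dgraph_cases) (use a *(2,3) ve_neq_vb[of a \<delta>] ve_eq_iff[of b \<delta> a \<delta>] in auto)
    ultimately show ?thesis using East by simp
  qed
  then show ?thesis by (simp add: WE_functional_def)
qed

lemma acyclic_graph_dgraph:
  assumes "dterm \<delta>"
  shows "acyclic_graph (dgraph \<delta>)"
proof -
  obtain f :: "'b \<Rightarrow> nat" where
    f: "\<forall>\<beta>\<in>set_dexp \<delta>. \<forall>\<gamma>\<in>set_dexp \<delta>. Eb \<beta> \<inter> Wb \<gamma> \<noteq> {} \<longrightarrow> f \<beta> < f \<gamma>"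
    using dterm_rank[OF assms] by blast
  \<comment> \<open>A height: 0 at western outer vertices, ranks shifted by one at leaves, and a
    value above all of these at eastern outer vertices.\<close>
  define g where "g v = (if v \<in> range vb then Suc (f (inv vb v))
    else if v \<in> ve ` (west \<delta> - east \<delta>) then 0 else Suc (Suc (Max (f ` set_dexp \<delta>))))" for v
  have g_vb: "g (vb \<beta>) = Suc (f \<beta>)" for \<beta> using inj_vb by (simp add: g_def)
  have g_west: "g (ve a) = 0" if "a \<in> west \<delta>" "a \<notin> east \<delta>" for a
    using that ve_neq_vb[of a \<delta>] by (auto simp: g_def)
  \<comment> \<open>The \<open>- 1\<close> matches the \<open>Suc\<close> in \<open>g_vb\<close>;
    the strict inequality makes truncation harmless.\<close>
  have g_east: "f \<beta> < g (ve a) - 1" if "a \<in> east \<delta>" "a \<notin> west \<delta>" "\<beta> \<in> set_dexp \<delta>" for a \<beta>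
  proof -
    have "ve a \<notin> ve ` (west \<delta> - east \<delta>)" using that ve_eq_iff[of a \<delta> _ \<delta>] by auto
    moreover have "ve a \<notin> range vb" using that ve_neq_vb[of a \<delta>] by auto
    moreover have "f \<beta> \<le> Max (f ` set_dexp \<delta>)" using that by (intro Max_ge) auto
    ultimately show ?thesis by (simp add: g_def)
  qed
  show ?thesis
  proof (rule acyclic_graphI)
    fix a assume "a \<in> arcs (dgraph \<delta>)"
    then have a: "a \<in> west \<delta> \<union> east \<delta>" by simp
    show "g (tail (dgraph \<delta>) a) < g (head (dgraph \<delta>) a)"
      using assms a
    proof (cases rule: tail_dgraph_cases)
      case (1 \<beta>)
      show ?thesis
        using assms a
      proof (cases rule: head_dgraph_cases)
        case (1 \<gamma>)
        then show ?thesis using \<open>tail (dgraph \<delta>) a = vb \<beta>\<close> \<open>\<beta> \<in> set_dexp \<delta>\<close> \<open>a \<in> Eb \<beta>\<close> f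
          by (auto simp: g_vb)
      next
        case 2
        then show ?thesis using \<open>tail (dgraph \<delta>) a = vb \<beta>\<close> \<open>\<beta> \<in> set_dexp \<delta>\<close> g_east[of a \<beta>]
          by (auto simp: g_vb)
      qed
    next
      case 2
      then show ?thesis using head_dgraph(1)[OF assms] by (auto simp: g_vb g_west elim!: westE)
    qed
  qed
qed

lemma weakly_connected_dgraph:
  assumes "dterm \<delta>"
  shows "weakly_connected (dgraph \<delta>)"
proof -
  let ?R = "(adjacency (dgraph \<delta>))\<^sup>*"
  obtain \<pi> where \<pi>: "\<pi> \<in> set_dexp \<delta>" using set_dexp_nonempty by blast
  \<comment> \<open>The closure principle is applied to the leaves reachable from \<pi>; each outer
    vertex is then adjacent to some leaf vertex.\<close>
  have "set_dexp \<delta> \<subseteq> {\<beta>. (vb \<pi>, vb \<beta>) \<in> ?R}"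
    using assms \<pi>
  proof (rule dterm_connected)
    fix \<beta> \<gamma>
    assume *: "\<beta> \<in> set_dexp \<delta>" "\<gamma> \<in> set_dexp \<delta>" "Eb \<beta> \<inter> Wb \<gamma> \<noteq> {}"
    then obtain a where a: "a \<in> Eb \<beta>" "a \<in> Wb \<gamma>" by blast
    then have "tail (dgraph \<delta>) a = vb \<beta>" "head (dgraph \<delta>) a = vb \<gamma>" "a \<in> arcs (dgraph \<delta>)"
      using * tail_dgraph[OF assms] head_dgraph[OF assms] by (auto simp: east_def)
    then have "(vb \<beta>, vb \<gamma>) \<in> adjacency (dgraph \<delta>)" "(vb \<gamma>, vb \<beta>) \<in> adjacency (dgraph \<delta>)"
      using adjacencyI[of a "dgraph \<delta>"] by auto
    then show "\<beta> \<in> {\<beta>. (vb \<pi>, vb \<beta>) \<in> ?R} \<longleftrightarrow> \<gamma> \<in> {\<beta>. (vb \<pi>, vb \<beta>) \<in> ?R}"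
      by (auto intro: rtrancl_into_rtrancl)
  qed simp
  then have vb: "(vb \<pi>, vb \<beta>) \<in> ?R" if "\<beta> \<in> set_dexp \<delta>" for \<beta> using that by auto
  have "(vb \<pi>, ve a) \<in> ?R" if "a \<in> west \<delta>" "a \<notin> east \<delta>" for a
  proof -
    obtain \<beta> where \<beta>: "\<beta> \<in> set_dexp \<delta>" "a \<in> Wb \<beta>" using \<open>a \<in> west \<delta>\<close> by (rule westE)
    then have "(vb \<beta>, ve a) \<in> adjacency (dgraph \<delta>)"
      using adjacencyI(2)[of a "dgraph \<delta>"] head_dgraph(1)[OF assms \<beta>]
        tail_dgraph(2)[OF assms that] that by simp
    then show ?thesis using vb[OF \<beta>(1)] by (rule rtrancl_into_rtrancl[rotated])
  qed
  moreover have "(vb \<pi>, ve a) \<in> ?R" if "a \<in> east \<delta>" "a \<notin> west \<delta>" for a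
  proof -
    obtain \<beta> where \<beta>: "\<beta> \<in> set_dexp \<delta>" "a \<in> Eb \<beta>" using \<open>a \<in> east \<delta>\<close> by (rule eastE)
    then have "(vb \<beta>, ve a) \<in> adjacency (dgraph \<delta>)"
      using adjacencyI(1)[of a "dgraph \<delta>"] tail_dgraph(1)[OF assms \<beta>]
        head_dgraph(2)[OF assms that] that by simp
    then show ?thesis using vb[OF \<beta>(1)] by (rule rtrancl_into_rtrancl[rotated])
  qed
  ultimately show ?thesis
    using vb by (intro weakly_connectedI[OF is_graph_dgraph[OF assms], of "vb \<pi>"]) auto
qed

lemma D_graph_dgraph:
  assumes "dterm \<delta>"
  shows "D_graph (dgraph \<delta>)"
proof -
  obtain \<beta> where \<beta>: "\<beta> \<in> set_dexp \<delta>" using set_dexp_nonempty by blast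
  then have "inner_vertex (dgraph \<delta>) (vb \<beta>)"
    using not_side_vertex_vb[OF assms] by (auto simp: inner_vertex_def)
  moreover have "finite (west \<delta>)" "finite (east \<delta>)"
    using finite_Wb finite_Eb by (auto simp: west_def east_def)
  ultimately show ?thesis
    using assms is_graph_dgraph acyclic_graph_dgraph WE_functional_dgraph weakly_connected_dgraph
    unfolding D_graph_def by auto
qed

section \<open>Agreement of the closed form with the interpretation\<close>

lemma dgraph_Basic: "dgraph (Basic \<beta>) = basic_graph Wb Eb ve vb \<beta>"
  using Wb_Eb_disjoint[of \<beta>]
  by (auto simp: dgraph_def basic_graph_def fun_eq_iff
      intro!: pre_digraph.equality arg_cong[where f = vb] the_equality)

text \<open>The shared edges \<open>C\<close> are exactly the outer edges common to both graphs, so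
  removing their vertices leaves the outer vertices of the joined term.\<close>

lemma juncture_dgraph:
  assumes "dterm (P \<box> Q)"
  shows "juncture (dgraph P) (dgraph Q) = Some (dgraph (P \<box> Q))"
proof -
  have d: "dterm P" "dterm Q" "west P \<inter> west Q = {}" "east P \<inter> east Q = {}"
     "west P \<inter> east Q = {}" "east P \<inter> west Q \<noteq> {}"
    using assms by (auto simp: dterm_Junc_iff)
  have dis: "set_dexp P \<inter> set_dexp Q = {}" using assms by (rule dterm_Junc_disjoint)
  define C where "C = east P \<inter> west Q"
  have C: "(west P \<union> east P) \<inter> (west Q \<union> east Q) = C" using d unfolding C_def by blast
  have CP: "C \<subseteq> east P - west P" and CQ: "C \<subseteq> west Q - east Q" using d unfolding C_def by blast+
  have hP: "head (dgraph P) a = ve a" and tQ: "tail (dgraph Q) a = ve a" if "a \<in> C" for a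
    using that CP CQ head_dgraph(2)[OF d(1), of a] tail_dgraph(2)[OF d(2), of a] by auto
  then have img: "head (dgraph P) ` C = ve ` C" by simp
  \<comment> \<open>The outer edges, that is, those with an end at their own vertex.\<close>
  define S where "S \<delta> = (west \<delta> - east \<delta>) \<union> (east \<delta> - west \<delta>)" for \<delta>
  have S: "S P \<inter> S Q = C" "S (P \<box> Q) = (S P \<union> S Q) - C"
    using d unfolding C_def S_def by auto
  have SA: "S \<delta> \<subseteq> \<A>" for \<delta> using west_subset east_subset unfolding S_def by blast
  have vS: "vb ` X \<inter> ve ` S \<delta> = {}" for X \<delta> using ve_neq_vb[of _ \<delta>] by (auto simp: S_def)
  have "vb ` set_dexp P \<inter> vb ` set_dexp Q = {}"
    using dis by (simp add: image_Int[OF inj_vb, symmetric])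
  then have "verts (dgraph P) \<inter> verts (dgraph Q) = ve ` S P \<inter> ve ` S Q"
    unfolding verts_dgraph S_def[symmetric] using vS by blast
  also have "\<dots> = ve ` C" using inj_on_image_Int[OF inj_ve SA SA] S by metis
  finally have "verts (dgraph P) \<inter> verts (dgraph Q) = ve ` C" .
  then have def: "juncture_defined (dgraph P) (dgraph Q)"
    using C CP CQ d img hP tQ D_graph_dgraph side_edge_dgraph_iff
    by (auto simp: juncture_defined_def C_def)
  have S_Junc: "ve ` S (P \<box> Q) = (ve ` S P \<union> ve ` S Q) - ve ` C"
    unfolding S(2) image_Un[symmetric]
    using SA[of P] SA[of Q] S(1) by (intro inj_on_image_set_diff[OF inj_ve]) auto
  have vC: "vb ` X \<inter> ve ` C = {}" for X
    using vS[of X P] S(1) by blast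
  have verts: "verts (dgraph (P \<box> Q)) = verts (dgraph P) \<union> verts (dgraph Q) - ve ` C"
    unfolding verts_dgraph S_def[symmetric] dexp.set image_Un S_Junc
    using vC[of "set_dexp P"] vC[of "set_dexp Q"] by blast
  have tail: "tail (dgraph (P \<box> Q)) a =
      (if a \<in> west P \<union> east P then tail (dgraph P) a else tail (dgraph Q) a)"
    if "a \<in> west P \<union> east P \<union> (west Q \<union> east Q)" for a
  proof -
    from that have "a \<in> west (P \<box> Q) \<union> east (P \<box> Q)" by auto
    with assms show ?thesis
    proof (cases rule: tail_dgraph_cases)
      case (1 \<beta>)
      then show ?thesis
      proof (cases "\<beta> \<in> set_dexp P")
        case True
        then show ?thesis using 1 tail_dgraph(1)[OF d(1) True, of a] by (auto simp: east_def)
      next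
        case False
        then have "\<beta> \<in> set_dexp Q" using 1 by auto
        \<comment> \<open>An edge leaving a leaf of \<open>Q\<close> does not occur in
          \<open>P\<close> at all, so the second branch applies.\<close>
        moreover from this have "a \<in> east Q" using 1 by (auto simp: east_def)
        then have "a \<notin> west P \<union> east P" using d by auto
        ultimately show ?thesis using 1 tail_dgraph(1)[OF d(2), of \<beta> a] by simp
      qed
    next
      case 2
      then show ?thesis using tail_dgraph(2)[OF d(1), of a] tail_dgraph(2)[OF d(2), of a] by auto
    qed
  qed
  have head: "head (dgraph (P \<box> Q)) a =
      (if a \<in> west Q \<union> east Q then head (dgraph Q) a else head (dgraph P) a)"
    if "a \<in> west P \<union> east P \<union> (west Q \<union> east Q)" for a
  proof -
    from that have "a \<in> west (P \<box> Q) \<union> east (P \<box> Q)" by auto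
    with assms show ?thesis
    proof (cases rule: head_dgraph_cases)
      case (1 \<beta>)
      then show ?thesis
      proof (cases "\<beta> \<in> set_dexp Q")
        case True
        then show ?thesis using 1 head_dgraph(1)[OF d(2) True, of a] by (auto simp: west_def)
      next
        case False
        then have "\<beta> \<in> set_dexp P" using 1 by auto
        moreover from this have "a \<in> west P" using 1 by (auto simp: west_def)
        then have "a \<notin> west Q \<union> east Q" using d by auto
        ultimately show ?thesis using 1 head_dgraph(1)[OF d(1), of \<beta> a] by simp
      qed
    next
      case 2
      then show ?thesis using head_dgraph(2)[OF d(1), of a] head_dgraph(2)[OF d(2), of a] by auto
    qed
  qed
  show ?thesis
    unfolding juncture_def if_P[OF def] option.inject
  proof (rule pre_digraph.equality)
    show "tail \<lparr>verts = verts (dgraph P) \<union> verts (dgraph Q)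
            - head (dgraph P) ` (arcs (dgraph P) \<inter> arcs (dgraph Q)),
          arcs = arcs (dgraph P) \<union> arcs (dgraph Q),
          tail = \<lambda>a\<in>arcs (dgraph P) \<union> arcs (dgraph Q).
            if a \<in> arcs (dgraph P) then tail (dgraph P) a else tail (dgraph Q) a,
          head = \<lambda>a\<in>arcs (dgraph P) \<union> arcs (dgraph Q).
            if a \<in> arcs (dgraph Q) then head (dgraph Q) a else head (dgraph P) a\<rparr> =
        tail (dgraph (P \<box> Q))"
      using tail dgraph_undefined[of _ "P \<box> Q"] by (auto simp: fun_eq_iff restrict_def)
    show "head \<lparr>verts = verts (dgraph P) \<union> verts (dgraph Q)
            - head (dgraph P) ` (arcs (dgraph P) \<inter> arcs (dgraph Q)),
          arcs = arcs (dgraph P) \<union> arcs (dgraph Q),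
          tail = \<lambda>a\<in>arcs (dgraph P) \<union> arcs (dgraph Q).
            if a \<in> arcs (dgraph P) then tail (dgraph P) a else tail (dgraph Q) a,
          head = \<lambda>a\<in>arcs (dgraph P) \<union> arcs (dgraph Q).
            if a \<in> arcs (dgraph Q) then head (dgraph Q) a else head (dgraph P) a\<rparr> =
        head (dgraph (P \<box> Q))"
      using head dgraph_undefined[of _ "P \<box> Q"] by (auto simp: fun_eq_iff restrict_def)
  qed (use verts C img in auto)
qed

text \<open>In particular, every juncture met while interpreting a D-term is defined.\<close>

lemma iota_dterm: "dterm \<delta> \<Longrightarrow> iota Wb Eb ve vb \<delta> = Some (dgraph \<delta>)"
proof (induction \<delta>)
  case (Junc P Q)
  then show ?case using juncture_dgraph[of P Q] by (simp add: dterm_Junc_iff)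
qed (simp add: dgraph_Basic)

text \<open>The leaves can be read off as the vertices in the range of \<open>vb\<close>; conversely
  \<open>dgraph\<close> is built from the leaf set only.\<close>

lemma dgraph_eq_iff: "dgraph \<delta> = dgraph \<delta>' \<longleftrightarrow> set_dexp \<delta> = set_dexp \<delta>'"
proof
  assume "dgraph \<delta> = dgraph \<delta>'"
  then have "verts (dgraph \<delta>) \<inter> range vb = verts (dgraph \<delta>') \<inter> range vb" by simp
  moreover have "verts (dgraph \<epsilon>) \<inter> range vb = vb ` set_dexp \<epsilon>" for \<epsilon>
    using ve_neq_vb[of _ \<epsilon>] by auto
  ultimately show "set_dexp \<delta> = set_dexp \<delta>'" using inj_vb by (simp add: inj_image_eq_iff)
next
  assume "set_dexp \<delta> = set_dexp \<delta>'"
  then show "dgraph \<delta> = dgraph \<delta>'" by (simp only: dgraph_def west_def east_def)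
qed

end

theorem theorem1p6p4:
  fixes \<A> :: "'a set"
    and Wb Eb :: "'b \<Rightarrow> 'a set"
    and ve :: "'a \<Rightarrow> 'v"
    and vb :: "'b \<Rightarrow> 'v"
    and \<delta> \<delta>' :: "'b dexp"
  assumes "infinite \<A>"
    and "\<And>\<beta>. Wb \<beta> \<subseteq> \<A> \<and> finite (Wb \<beta>) \<and> Wb \<beta> \<noteq> {}"
    and "\<And>\<beta>. Eb \<beta> \<subseteq> \<A> \<and> finite (Eb \<beta>) \<and> Eb \<beta> \<noteq> {}"
    and "\<And>\<beta>. Wb \<beta> \<inter> Eb \<beta> = {}"
    and "inj_on ve \<A>" and "inj vb" and "ve ` \<A> \<inter> range vb = {}"
    and "is_dterm Wb Eb \<delta>" and "is_dterm Wb Eb \<delta>'"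
  shows "derivable Wb Eb \<delta> \<delta>' \<longleftrightarrow>
    (\<exists>D. D_graph D \<and> iota Wb Eb ve vb \<delta> = Some D \<and> iota Wb Eb ve vb \<delta>' = Some D)"
proof -
  interpret interpreted_dterms Wb Eb \<A> ve vb
    using assms by unfold_locales auto
  \<comment> \<open>Both sides amount to equality of the leaf sets; the witness for \<open>D\<close>
    is \<open>dgraph \<delta>\<close>.\<close>
  show ?thesis
    using assms(8,9) derivable_iff_set_dexp_eq[of \<delta> \<delta>'] dgraph_eq_iff[of \<delta> \<delta>']
      D_graph_dgraph[of \<delta>] iota_dterm[of \<delta>] iota_dterm[of \<delta>']
    by auto
qed

end
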